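(* For every integer $t\ge 1$ and all integers $n_1,n_2,\ldots,n_t\ge 2$, the complete multipartite graph $K_{n_1,n_1,n_2,n_2,\ldots,n_t,n_t}$ (with $2t$ parts, where for each $i=1,\dots,t$ there are two parts of size $n_i$ listed) has property (P).
   Context: Graphs are finite and simple. For a graph $G$ on vertex set $\{1,\dots,n\}$, $S(G)$ is the set of real symmetric $n\times n$ matrices $A$ such that for all $i\ne j$, $A_{ij}\neq 0$ if and only if $ij\in E(G)$ (diagonal entries are unrestricted). $A(i)$ denotes the principal submatrix of $A$ obtained by deleting row and column $i$, and $m_A(0)$ the multiplicity of $0$ as an eigenvalue of $A$. A vertex $i$ is a P-vertex of $A$ if $m_{A(i)}(0)-m_A(0)=1$, and $P_\nu(A)$ is the number of P-vertices of $A$. $G$ has property (P) if there exists a nonsingular $A\in S(G)$ with $P_\nu(A)=n$ (equivalently, a nonsingular $A\in S(G)$ with $\det A(i)=0$ for all $i$, i.e. $A^{-1}$ has zero diagonal). *)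

theory Defs
  imports
    "Jordan_Normal_Form.Char_Poly"
    "Graph_Theory.Pair_Digraph"
begin

text \<open>
  A finite simple graph is a \<^locale>\<open>pair_graph\<close>: a finite, symmetric, loop-free set of arcs,
  the edge \<open>ij\<close> being the pair of arcs \<open>(i, j)\<close>, \<open>(j, i)\<close>. Matrices are indexed from \<open>0\<close>, so the
  vertex set is \<open>{0..<n}\<close> in place of \<open>{1,\<dots>,n}\<close>; the following definitions are meant
  for graphs with this vertex set.
\<close>

definition matrices_of :: "nat pair_pre_digraph \<Rightarrow> real mat set" where
  "matrices_of G = {A \<in> carrier_mat (card (pverts G)) (card (pverts G)).
     transpose_mat A = A \<and>
     (\<forall>i\<in>pverts G. \<forall>j\<in>pverts G. i \<noteq> j \<longrightarrow> (A $$ (i, j) \<noteq> 0 \<longleftrightarrow> (i, j) \<in> parcs G))}"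

text \<open>The multiplicity of \<open>x\<close> as an eigenvalue; it is \<open>0\<close> if \<open>x\<close> is not an eigenvalue.\<close>

definition eigen_mult :: "real mat \<Rightarrow> real \<Rightarrow> nat" where
  "eigen_mult A x = order x (char_poly A)"

definition P_vertex :: "real mat \<Rightarrow> nat \<Rightarrow> bool" where
  "P_vertex A i \<longleftrightarrow> i < dim_row A \<and>
     int (eigen_mult (mat_delete A i i) 0) - int (eigen_mult A 0) = 1"

definition P_nu :: "real mat \<Rightarrow> nat" where
  "P_nu A = card {i. P_vertex A i}"

definition property_P :: "nat pair_pre_digraph \<Rightarrow> bool" where
  "property_P G \<longleftrightarrow>
     (\<exists>A \<in> matrices_of G. invertible_mat A \<and> P_nu A = card (pverts G))"

text \<open>
  The complete multipartite graph with list of part sizes \<open>ms\<close>. Its parts are consecutive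
  intervals of \<open>{0..<sum_list ms}\<close>, part number \<open>k\<close> having size \<open>ms ! k\<close>.
\<close>

definition part :: "nat list \<Rightarrow> nat \<Rightarrow> nat set" where
  "part ms k = {sum_list (take k ms)..<sum_list (take (Suc k) ms)}"

definition complete_multipartite :: "nat list \<Rightarrow> nat pair_pre_digraph" where
  "complete_multipartite ms =
     \<lparr> pverts = {0..<sum_list ms},
       parcs = {(u, v). \<exists>k<length ms. \<exists>l<length ms. k \<noteq> l \<and> u \<in> part ms k \<and> v \<in> part ms l} \<rparr>"

lemma card_part: "k < length ms \<Longrightarrow> card (part ms k) = ms ! k"
  by (simp add: part_def take_Suc_conv_app_nth)

lemma sum_list_take_mono: "k \<le> l \<Longrightarrow> sum_list (take k ms) \<le> sum_list (take l (ms :: nat list))"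
  by (metis le_add1 le_Suc_ex sum_list_append take_add)

lemma part_subset: "part ms k \<subseteq> {0..<sum_list ms}"
proof -
  have "sum_list (take (Suc k) ms) \<le> sum_list ms"
    by (metis append_take_drop_id le_add1 sum_list_append)
  then show ?thesis by (auto simp: part_def)
qed

lemma part_disjoint:
  assumes "k \<noteq> l"
  shows "part ms k \<inter> part ms l = {}"
proof -
  have "part ms k \<inter> part ms l = {}" if "k < l" for k l
    using sum_list_take_mono[of "Suc k" l ms] that by (auto simp: part_def)
  with assms show ?thesis by (metis inf_commute linorder_neqE_nat)
qed

lemma Union_part: "(\<Union>k<length ms. part ms k) = {0..<sum_list ms}"
proof -
  have "(\<Union>k<m. part ms k) = {0..<sum_list (take m ms)}" for m
  proof (induction m)
    case (Suc m)
    show ?case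
      using sum_list_take_mono[of m "Suc m" ms]
      unfolding lessThan_Suc UN_insert Suc.IH by (auto simp: part_def)
  qed simp
  from this[of "length ms"] show ?thesis by simp
qed

lemma pair_graph_complete_multipartite: "pair_graph (complete_multipartite ms)"
proof -
  let ?G = "complete_multipartite ms"
  have sub: "parcs ?G \<subseteq> {0..<sum_list ms} \<times> {0..<sum_list ms}"
    using part_subset by (fastforce simp: complete_multipartite_def)
  then have "finite (parcs ?G)"
    by (rule finite_subset) simp
  moreover have "fst e \<noteq> snd e" if "e \<in> parcs ?G" for e
    using that part_disjoint by (fastforce simp: complete_multipartite_def)
  moreover have "symmetric (with_proj ?G)"
    by (auto simp: symmetric_def sym_def complete_multipartite_def)
  moreover have "pverts ?G = {0..<sum_list ms}"
    by (simp add: complete_multipartite_def)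
  ultimately show ?thesis
    using sub by unfold_locales auto
qed

end

theory Submission
  imports Defs
begin

section \<open>P-vertices from a zero diagonal of the inverse\<close>

lemma order_eq_Suc_0:
  fixes p :: "'a :: field_char_0 poly"
  assumes "coeff p 0 = 0" "coeff p 1 \<noteq> 0"
  shows "order 0 p = 1"
proof -
  have "poly (pderiv p) 0 \<noteq> 0" "poly p 0 = 0"
    using assms by (simp_all add: poly_0_coeff_0 coeff_pderiv)
  moreover from this have "p \<noteq> 0" "order 0 (pderiv p) = 0" by (auto intro: order_0I)
  ultimately show ?thesis using order_pderiv[of p 0] by simp
qed

text \<open>A zero constant coefficient would make 0 an eigenvalue, but the left inverse
  \<open>M\<close> sends \<open>A v = 0\<close> back to \<open>v\<close>.\<close>

lemma coeff_char_poly_0_neq_0: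
  fixes A M :: "'a :: field mat"
  assumes A: "A \<in> carrier_mat n n" and M: "M \<in> carrier_mat n n" and MA: "M * A = 1\<^sub>m n"
  shows "coeff (char_poly A) 0 \<noteq> 0"
proof
  assume "coeff (char_poly A) 0 = 0"
  then have "eigenvalue A 0"
    by (simp add: eigenvalue_root_char_poly[OF A] poly_0_coeff_0)
  then obtain v where v: "v \<in> carrier_vec n" "v \<noteq> 0\<^sub>v n" "A *\<^sub>v v = 0 \<cdot>\<^sub>v v"
    using A by (auto simp: eigenvalue_def eigenvector_def)
  have "v = (M * A) *\<^sub>v v" using v by (simp add: MA)
  also have "\<dots> = M *\<^sub>v (A *\<^sub>v v)" using A M v by simp
  also have "\<dots> = 0\<^sub>v n" using M v by (auto simp: scalar_prod_def)
  finally show False using v by simp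
qed

text \<open>
  Let \<open>v\<close> be column \<open>i\<close> of the adjugate of \<open>x I - A\<close>, so that \<open>(x I - A) v = p e\<^sub>i\<close> with \<open>p\<close> the
  characteristic polynomial of \<open>A\<close>, while entry \<open>i\<close> of \<open>v\<close> is that of \<open>A(i)\<close>. The constant and the
  linear coefficients in \<open>x\<close> give \<open>v(0) = - p(0) M e\<^sub>i\<close> and, after a scalar product with
  \<open>v(0)\<close>, \<open>v\<^sub>i'(0) = - |v(0)|\<^sup>2 / p(0) \<noteq> 0\<close>.
\<close>

lemma P_vertex_if_inverse_diag_0:
  assumes A: "A \<in> carrier_mat n n" and M: "M \<in> carrier_mat n n"
    and sym: "transpose_mat A = A" and MA: "M * A = 1\<^sub>m n"
    and i: "i < n" and diag: "M $$ (i, i) = 0"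
  shows "P_vertex A i"
proof -
  define p where "p = char_poly A"
  define C where "C = char_poly_matrix A"
  define v where "v = (\<lambda>j. adj_mat C $$ (j, i))"
  have C: "C \<in> carrier_mat n n" using A by (simp add: C_def)
  have p0: "coeff p 0 \<noteq> 0" unfolding p_def by (rule coeff_char_poly_0_neq_0[OF A M MA])
  have sym': "A $$ (j, k) = A $$ (k, j)" if "j < n" "k < n" for j k
    using that A arg_cong[OF sym, of "\<lambda>B. B $$ (j, k)"] by auto
  have vi: "v i = char_poly (mat_delete A i i)"
  proof -
    \<comment> \<open>Forming \<open>x I - A\<close> commutes with deleting row and column
      \<open>i\<close>, and the cofactor sign on the diagonal is 1.\<close>
    have "char_poly_matrix (mat_delete A i i) = mat_delete C i i"
      using A i by (intro eq_matI) (auto simp: C_def char_poly_matrix_def mat_delete_def)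
    then show ?thesis
      using C i unfolding v_def adj_mat_def char_poly_def cofactor_def by simp
  qed
  have rows: "[:0, 1:] * v k - (\<Sum>j<n. [:A $$ (k, j):] * v j) = (if k = i then p else 0)"
    if k: "k < n" for k
  proof -
    have "(\<Sum>j<n. C $$ (k, j) * v j) = (C * adj_mat C) $$ (k, i)"
      using k i C adj_mat(1)[OF C]
      by (simp add: scalar_prod_def v_def lessThan_atLeast0)
    also have "\<dots> = (if k = i then p else 0)"
      unfolding adj_mat(2)[OF C] using k i by (simp add: p_def char_poly_def C_def)
    finally have "(\<Sum>j<n. C $$ (k, j) * v j) = (if k = i then p else 0)" .
    moreover have "(\<Sum>j<n. C $$ (k, j) * v j)
      = (\<Sum>j<n. (if j = k then [:0, 1:] * v j else 0) - [:A $$ (k, j):] * v j)"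
      using A k by (intro sum.cong refl) (auto simp: C_def char_poly_matrix_def algebra_simps)
    ultimately show ?thesis using k by (simp add: sum_subtractf)
  qed
  have row0: "(\<Sum>j<n. A $$ (k, j) * coeff (v j) 0) = (if k = i then - coeff p 0 else 0)"
    if "k < n" for k
    using arg_cong[OF rows[OF that], of "\<lambda>q. coeff q 0"] by (auto simp: coeff_sum)
  have row1: "coeff (v k) 0 = (\<Sum>j<n. A $$ (k, j) * coeff (v j) 1) + (if k = i then coeff p 1 else 0)"
    if "k < n" for k
    using arg_cong[OF rows[OF that], of "\<lambda>q. coeff q 1"] by (auto simp: coeff_sum)
  have vi0: "coeff (v i) 0 = 0"
  proof -
    let ?u = "vec n (\<lambda>j. coeff (v j) 0)"
    have Au: "A *\<^sub>v ?u = vec n (\<lambda>k. if k = i then - coeff p 0 else 0)"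
      using A by (intro eq_vecI) (auto simp: scalar_prod_def row0[symmetric] lessThan_atLeast0)
    \<comment> \<open>Entry \<open>i\<close> of \<open>M (A u)\<close> is a multiple of
      \<open>M $$ (i, i)\<close>, which is 0.\<close>
    have "?u = M *\<^sub>v (A *\<^sub>v ?u)"
      using assoc_mult_mat_vec[OF M A, of ?u] by (simp add: MA)
    from arg_cong[OF this, of "\<lambda>w. w $ i"] show ?thesis
      using M i diag unfolding Au by (auto simp: scalar_prod_def if_distrib cong: if_cong)
  qed
  \<comment> \<open>One factor of each square is expanded by \<open>row1\<close>; its term in
    \<open>coeff p 1\<close> meets the factor \<open>coeff (v i) 0 = 0\<close>.\<close>
  have "(\<Sum>k<n. (coeff (v k) 0)\<^sup>2)
      = (\<Sum>k<n. coeff (v k) 0 * (\<Sum>j<n. A $$ (k, j) * coeff (v j) 1))"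
    using vi0 by (intro sum.cong refl) (subst power2_eq_square, subst (2) row1, auto)
  \<comment> \<open>Symmetry moves \<open>A\<close> onto the constant coefficients, where
    \<open>row0\<close> leaves only index \<open>i\<close>.\<close>
  also have "\<dots> = (\<Sum>j<n. coeff (v j) 1 * (\<Sum>k<n. A $$ (j, k) * coeff (v k) 0))"
    unfolding sum_distrib_left by (subst sum.swap) (auto intro!: sum.cong simp: sym')
  also have "\<dots> = - coeff p 0 * coeff (v i) 1"
    using i by (simp add: row0 if_distrib cong: if_cong)
  finally have norm: "(\<Sum>k<n. (coeff (v k) 0)\<^sup>2) = - coeff p 0 * coeff (v i) 1" .
  have vi1: "coeff (v i) 1 \<noteq> 0"
  proof
    assume "coeff (v i) 1 = 0"
    then have "\<forall>k<n. coeff (v k) 0 = 0"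
      using norm by (simp add: sum_nonneg_eq_0_iff)
    then show False using row0[OF i] p0 by simp
  qed
  have "order 0 p = 0" using p0 by (intro order_0I) (simp add: poly_0_coeff_0)
  with order_eq_Suc_0[OF vi0 vi1] show ?thesis
    using A i by (simp add: P_vertex_def eigen_mult_def vi p_def)
qed

text \<open>Removes eigenvalue multiplicities from the problem: it remains to exhibit a matrix of
  the graph together with its inverse.\<close>

lemma property_P_if_inverse_diag_0:
  assumes G: "pverts G = {0..<N}" and A: "A \<in> matrices_of G" and M: "M \<in> carrier_mat N N"
    and AM: "A * M = 1\<^sub>m N" and diag: "\<And>i. i < N \<Longrightarrow> M $$ (i, i) = 0"
  shows "property_P G"
proof -
  from A G have A': "A \<in> carrier_mat N N" and sym: "transpose_mat A = A"
    by (auto simp: matrices_of_def)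
  have MA: "M * A = 1\<^sub>m N" using mat_mult_left_right_inverse[OF A' M AM] .
  have "{i. P_vertex A i} = {0..<N}"
    using P_vertex_if_inverse_diag_0[OF A' M sym MA] diag A' by (auto simp: P_vertex_def)
  then have "P_nu A = card (pverts G)" by (simp add: P_nu_def G)
  moreover have "invertible_mat A"
    using A' M AM MA by (auto simp: invertible_mat_def inverts_mat_def)
  ultimately show ?thesis using A by (auto simp: property_P_def)
qed

section \<open>Vertices as pairs of a part and a position in it\<close>

lemma part_coords_mem_part_iff:
  assumes "p < length ms" "a < ms ! p"
  shows "sum_list (take p ms) + a \<in> part ms q \<longleftrightarrow> p = q"
proof -
  have "sum_list (take p ms) + a \<in> part ms p"
    using assms by (simp add: part_def take_Suc_conv_app_nth)
  then show ?thesis using part_disjoint[of p q ms] by auto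
qed

lemma bij_betw_part_coords:
  fixes ms :: "nat list"
  shows "bij_betw (\<lambda>(p, a). sum_list (take p ms) + a) (SIGMA p:{..<length ms}. {..<ms ! p}) {0..<sum_list ms}"
    (is "bij_betw ?h ?S _")
proof (rule bij_betw_imageI)
  have "p = q" if "p < length ms" "a < ms ! p" "q < length ms" "b < ms ! q"
    "sum_list (take p ms) + a = sum_list (take q ms) + b" for p a q b
    using part_coords_mem_part_iff[OF that(1,2)] part_coords_mem_part_iff[OF that(3,4)] that(5)
    by metis
  then show "inj_on ?h ?S"
    by (fastforce simp: inj_on_def)
  have "?h ` ?S = (\<Union>p<length ms. part ms p)"
  proof (intro subset_antisym subsetI)
    fix v assume "v \<in> (\<Union>p<length ms. part ms p)"
    then obtain p where "p < length ms" "v \<in> part ms p" by auto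
    then show "v \<in> ?h ` ?S"
      by (intro image_eqI[of _ _ "(p, v - sum_list (take p ms))"])
        (auto simp: part_def take_Suc_conv_app_nth)
  qed (auto simp: part_coords_mem_part_iff)
  then show "?h ` ?S = {0..<sum_list ms}" by (simp only: Union_part)
qed

text \<open>With pairs as indices, adjacency is just inequality of first components; the bijection
  \<open>f\<close> carries both kernels over to matrices on \<open>{0..<N}\<close>.\<close>

lemma complete_multipartite_property_P_if_kernel:
  fixes ms :: "nat list" and A M :: "nat \<times> nat \<Rightarrow> nat \<times> nat \<Rightarrow> real"
  defines "V \<equiv> (SIGMA p:{..<length ms}. {..<ms ! p})"
  assumes sym: "\<And>u v. u \<in> V \<Longrightarrow> v \<in> V \<Longrightarrow> A u v = A v u"
    and pat: "\<And>u v. u \<in> V \<Longrightarrow> v \<in> V \<Longrightarrow> u \<noteq> v \<Longrightarrow> A u v \<noteq> 0 \<longleftrightarrow> fst u \<noteq> fst v"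
    and inv: "\<And>u v. u \<in> V \<Longrightarrow> v \<in> V \<Longrightarrow> (\<Sum>r\<in>V. A u r * M r v) = (if u = v then 1 else 0)"
    and diag: "\<And>u. u \<in> V \<Longrightarrow> M u u = 0"
  shows "property_P (complete_multipartite ms)"
proof -
  define N where "N = sum_list ms"
  define h where "h = (\<lambda>(p, a). sum_list (take p ms) + a)"
  define f where "f = inv_into V h"
  have h: "bij_betw h V {0..<N}"
    unfolding h_def V_def N_def by (rule bij_betw_part_coords)
  then have f: "bij_betw f {0..<N} V" unfolding f_def by (rule bij_betw_inv_into)
  have fV: "f i \<in> V" if "i < N" for i using f that by (auto simp: bij_betw_def)
  have hf: "h (f i) = i" if "i < N" for i
    using h that by (simp add: f_def bij_betw_inv_into_right)
  have f_inj: "f i = f j \<longleftrightarrow> i = j" if "i < N" "j < N" for i j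
    using hf that by metis
  have f_part: "i \<in> part ms q \<longleftrightarrow> fst (f i) = q" if "i < N" for i q
    using part_coords_mem_part_iff[of "fst (f i)" ms "snd (f i)" q] fV[OF that] hf[OF that]
    by (auto simp: V_def h_def)
  let ?G = "complete_multipartite ms"
  let ?A = "mat N N (\<lambda>(i, j). A (f i) (f j))"
  let ?M = "mat N N (\<lambda>(i, j). M (f i) (f j))"
  have pverts: "pverts ?G = {0..<N}" by (simp add: complete_multipartite_def N_def)
  have arcs: "(i, j) \<in> parcs ?G \<longleftrightarrow> fst (f i) \<noteq> fst (f j)" if "i < N" "j < N" for i j
    using fV[OF that(1)] fV[OF that(2)] that
    by (auto simp: complete_multipartite_def f_part V_def)
  have "A (f i) (f j) \<noteq> 0 \<longleftrightarrow> (i, j) \<in> parcs ?G" if "i < N" "j < N" "i \<noteq> j" for i j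
    using that by (simp add: arcs pat fV f_inj)
  moreover have "transpose_mat ?A = ?A"
    by (rule eq_matI) (auto simp: fV sym)
  ultimately have "?A \<in> matrices_of ?G"
    by (simp add: matrices_of_def pverts)
  moreover have "?A * ?M = 1\<^sub>m N"
  proof (rule eq_matI)
    fix i j assume "i < dim_row (1\<^sub>m N :: real mat)" "j < dim_col (1\<^sub>m N :: real mat)"
    then have ij: "i < N" "j < N" by auto
    have "(?A * ?M) $$ (i, j) = (\<Sum>k\<in>{0..<N}. A (f i) (f k) * M (f k) (f j))"
      using ij by (simp add: scalar_prod_def)
    also have "\<dots> = (\<Sum>r\<in>V. A (f i) r * M r (f j))"
      by (rule sum.reindex_bij_betw[OF f])
    finally show "(?A * ?M) $$ (i, j) = 1\<^sub>m N $$ (i, j)"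
      using ij by (simp add: inv fV f_inj)
  qed auto
  ultimately show ?thesis
    using pverts diag fV by (intro property_P_if_inverse_diag_0[of _ N ?A ?M]) auto
qed

text \<open>
  The off-diagonal blocks \<open>z\<^sub>k z\<^sub>l\<^sup>T\<close> do not change the diagonal blocks \<open>E\<^sub>k = D\<^sub>k\<inverse>\<close> of the inverse,
  because \<open>z\<^sub>k\<close> is isotropic for \<open>E\<^sub>k\<close>: with \<open>w\<^sub>k = E\<^sub>k z\<^sub>k\<close>, all products \<open>z\<^sub>k\<^sup>T w\<^sub>k\<close> vanish.
\<close>

lemma block_rank_one_inverse:
  fixes D E :: "'a \<Rightarrow> 'a \<Rightarrow> 'c :: comm_ring_1" and z w :: "'a \<Rightarrow> 'c" and \<kappa> :: "'a \<Rightarrow> 'b"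
  defines "A \<equiv> \<lambda>u v. if \<kappa> u = \<kappa> v then D u v else z u * z v"
    and "M \<equiv> \<lambda>u v. if \<kappa> u = \<kappa> v then E u v else - (w u * w v)"
  assumes fin: "finite V"
    and DE: "\<And>u v. u \<in> V \<Longrightarrow> v \<in> V \<Longrightarrow> \<kappa> u = \<kappa> v \<Longrightarrow>
      (\<Sum>r\<in>{r\<in>V. \<kappa> r = \<kappa> v}. D u r * E r v) = (if u = v then 1 else 0)"
    and Dw: "\<And>u. u \<in> V \<Longrightarrow> (\<Sum>r\<in>{r\<in>V. \<kappa> r = \<kappa> u}. D u r * w r) = z u"
    and zE: "\<And>v. v \<in> V \<Longrightarrow> (\<Sum>r\<in>{r\<in>V. \<kappa> r = \<kappa> v}. z r * E r v) = w v"
    and zw: "\<And>u. u \<in> V \<Longrightarrow> (\<Sum>r\<in>{r\<in>V. \<kappa> r = \<kappa> u}. z r * w r) = 0"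
    and u: "u \<in> V" and v: "v \<in> V"
  shows "(\<Sum>r\<in>V. A u r * M r v) = (if u = v then 1 else 0)"
proof -
  have all: "(\<Sum>r\<in>V. z r * w r) = 0"
  proof -
    have "(\<Sum>r\<in>V. z r * w r) = (\<Sum>k\<in>\<kappa> ` V. \<Sum>r\<in>{r\<in>V. \<kappa> r = k}. z r * w r)"
      by (rule sum.group[symmetric]) (use fin in auto)
    also have "\<dots> = 0" using zw by (intro sum.neutral) auto
    finally show ?thesis .
  qed
  let ?B = "\<lambda>u. {r\<in>V. \<kappa> r = \<kappa> u}"
  show ?thesis
  proof (cases "\<kappa> u = \<kappa> v")
    case True
    have "(\<Sum>r\<in>V. A u r * M r v) = (\<Sum>r\<in>?B v. A u r * M r v) + (\<Sum>r\<in>V - ?B v. A u r * M r v)"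
      using fin by (subst sum.subset_diff[of "?B v" V]) auto
    also have "(\<Sum>r\<in>?B v. A u r * M r v) = (\<Sum>r\<in>?B v. D u r * E r v)"
      using True by (intro sum.cong) (auto simp: A_def M_def)
    also have "(\<Sum>r\<in>V - ?B v. A u r * M r v) = (\<Sum>r\<in>V - ?B v. - (z u * w v) * (z r * w r))"
      using True by (intro sum.cong) (auto simp: A_def M_def)
    \<comment> \<open>Both the total and the block sum of \<open>z r * w r\<close> vanish, so rows
      outside the block contribute nothing.\<close>
    also have "\<dots> = - (z u * w v) * ((\<Sum>r\<in>V. z r * w r) - (\<Sum>r\<in>?B v. z r * w r))"
      using fin by (subst sum_diff[symmetric]) (auto simp: sum_distrib_left)
    finally show ?thesis using True u v by (simp add: all zw DE)
  next
    case False
    \<comment> \<open>The block of \<open>u\<close> yields \<open>- (z u * w v)\<close>, the block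
      of \<open>v\<close> yields \<open>z u * w v\<close>, and the remaining blocks yield 0 by
      isotropy.\<close>
    have "(\<Sum>r\<in>V. A u r * M r v)
      = (\<Sum>r\<in>?B u. A u r * M r v) + ((\<Sum>r\<in>?B v. A u r * M r v)
        + (\<Sum>r\<in>V - ?B u - ?B v. A u r * M r v))"
    proof -
      have "?B v \<subseteq> V - ?B u" using False by auto
      from sum.subset_diff[OF this, of "\<lambda>r. A u r * M r v"]
        sum.subset_diff[of "?B u" V "\<lambda>r. A u r * M r v"]
      show ?thesis using fin by (simp add: add.commute)
    qed
    also have "(\<Sum>r\<in>?B u. A u r * M r v) = (\<Sum>r\<in>?B u. - w v * (D u r * w r))"
      using False by (intro sum.cong) (auto simp: A_def M_def)
    also have "\<dots> = - (z u * w v)"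
      unfolding sum_distrib_left[symmetric] Dw[OF u] by simp
    also have "(\<Sum>r\<in>?B v. A u r * M r v) = (\<Sum>r\<in>?B v. z u * (z r * E r v))"
      using False by (intro sum.cong) (auto simp: A_def M_def)
    also have "\<dots> = z u * w v"
      unfolding sum_distrib_left[symmetric] zE[OF v] by simp
    also have "(\<Sum>r\<in>V - ?B u - ?B v. A u r * M r v)
        = (\<Sum>r\<in>V - ?B u - ?B v. - (z u * w v) * (z r * w r))"
      by (intro sum.cong) (auto simp: A_def M_def)
    also have "\<dots> = - (z u * w v) * (\<Sum>r\<in>V - ?B u - ?B v. z r * w r)"
      by (rule sum_distrib_left[symmetric])
    also have "(\<Sum>r\<in>V - ?B u - ?B v. z r * w r)
      = (\<Sum>r\<in>V. z r * w r) - (\<Sum>r\<in>?B u. z r * w r) - (\<Sum>r\<in>?B v. z r * w r)"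
      using fin False by (subst sum_diff, auto)+
    finally show ?thesis using False u v by (auto simp: all zw)
  qed
qed

section \<open>The construction for pairs of equal parts\<close>

lemma nth_concat_pairs:
  "p < 2 * length xs \<Longrightarrow> concat (map (\<lambda>x. [g x, g x]) xs) ! p = g (xs ! (p div 2))"
proof (induction xs arbitrary: p)
  case (Cons x xs)
  show ?case
  proof (cases "p < 2")
    case False
    then obtain q where "p = Suc (Suc q)" by (metis less_2_cases_iff not0_implies_Suc One_nat_def)
    then show ?thesis using Cons by simp
  qed (auto simp: less_2_cases_iff)
qed simp

lemma length_concat_pairs: "length (concat (map (\<lambda>x. [g x, g x]) xs)) = 2 * length xs"
  by (induction xs) auto

text \<open>
  Block \<open>k\<close> is \<open>D = [[0, B], [B, 0]]\<close> with \<open>B = I + J\<close>, \<open>B\<inverse> = I - J / (m + 1)\<close>. With \<open>y\<close> a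
  vector of zero sum, \<open>z = ((m + 1) 1, y)\<close> and \<open>w = D\<inverse> z = (y, 1)\<close> are orthogonal; \<open>y\<close>
  has no zero entries, which needs \<open>m \<ge> 2\<close>.
\<close>

theorem corollary4p5:
  fixes t :: nat and n :: "nat \<Rightarrow> nat"
  assumes "t \<ge> 1"
    and "\<forall>i\<in>{1..t}. n i \<ge> 2"
  shows "property_P (complete_multipartite (concat (map (\<lambda>i. [n i, n i]) [1..<Suc t])))"
proof -
  define ms where "ms = concat (map (\<lambda>i. [n i, n i]) [1..<Suc t])"
  \<comment> \<open>Blocks are counted from 0, the sizes \<open>n\<close> from 1.\<close>
  define m where "m = (\<lambda>k. n (Suc k))"
  have len: "length ms = 2 * t" unfolding ms_def length_concat_pairs by simp
  have nth: "ms ! p = m (p div 2)" if "p < 2 * t" for p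
    unfolding ms_def m_def using that by (subst nth_concat_pairs) (auto simp del: upt_Suc)
  have m2: "m k \<ge> 2" if "k < t" for k using assms(2) that by (auto simp: m_def)
  define V where "V = (SIGMA p:{..<length ms}. {..<ms ! p})"
  \<comment> \<open>Block \<open>k\<close> consists of the two equal parts \<open>2 * k\<close> and
    \<open>2 * k + 1\<close>.\<close>
  define \<kappa> :: "nat \<times> nat \<Rightarrow> nat" where "\<kappa> = (\<lambda>u. fst u div 2)"
  \<comment> \<open>The entry at 0 balances the \<open>m k - 1\<close> ones.\<close>
  define y :: "nat \<Rightarrow> nat \<Rightarrow> real" where "y = (\<lambda>k a. if a = 0 then 1 - real (m k) else 1)"
  define D :: "nat \<times> nat \<Rightarrow> nat \<times> nat \<Rightarrow> real" where
    "D = (\<lambda>u v. if fst u = fst v then 0 else (if snd u = snd v then 1 else 0) + 1)"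
  define E :: "nat \<times> nat \<Rightarrow> nat \<times> nat \<Rightarrow> real" where
    "E = (\<lambda>u v. if fst u = fst v then 0
       else (if snd u = snd v then 1 else 0) - 1 / (real (m (\<kappa> u)) + 1))"
  define z where "z = (\<lambda>u. if even (fst u) then real (m (\<kappa> u)) + 1 else y (\<kappa> u) (snd u))"
  define w where "w = (\<lambda>u. if even (fst u) then y (\<kappa> u) (snd u) else 1)"
  have V: "u \<in> V \<longleftrightarrow> \<kappa> u < t \<and> snd u < m (\<kappa> u)" for u
    by (cases u) (auto simp: V_def len nth \<kappa>_def)
  have fin: "finite V" by (simp add: V_def)
  have y_sum: "(\<Sum>a<m k. y k a) = 0" if "k < t" for k
  proof -
    have "0 < m k" using m2[OF that] by simp
    then obtain l where "m k = Suc l" by (cases "m k") auto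
    then show ?thesis by (simp add: y_def sum.lessThan_Suc_shift del: sum.lessThan_Suc)
  qed
  have y_nz: "y k a \<noteq> 0" if "k < t" for k a
    using m2[OF that] by (auto simp: y_def)
  have block: "(\<Sum>r\<in>{r\<in>V. \<kappa> r = k}. g r)
      = (\<Sum>c<m k. g (2 * k, c)) + (\<Sum>c<m k. g (Suc (2 * k), c))"
    if "k < t" for k and g :: "nat \<times> nat \<Rightarrow> real"
  proof -
    have "{r\<in>V. \<kappa> r = k} = {2 * k, Suc (2 * k)} \<times> {..<m k}"
      using that by (auto simp: V \<kappa>_def)
    then show ?thesis by (simp add: sum.cartesian_product')
  qed
  have vertex: "\<exists>k a. k < t \<and> a < m k \<and> (u = (2 * k, a) \<or> u = (Suc (2 * k), a))" if "u \<in> V" for u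
  proof -
    have "fst u = 2 * \<kappa> u \<or> fst u = Suc (2 * \<kappa> u)"
      unfolding \<kappa>_def by presburger
    then show ?thesis using that unfolding V by (metis prod.collapse)
  qed
  have \<kappa>: "\<kappa> (2 * k, a) = k" "\<kappa> (Suc (2 * k), a) = k" for k a
    by (simp_all add: \<kappa>_def)
  note entries = \<kappa> D_def E_def z_def w_def Suc_double_not_eq_double double_not_eq_Suc_double
  have delta: "(\<Sum>c<m k. (if a = c then 1 else 0) * g c) = g a"
    "(\<Sum>c<m k. g c * (if c = a then 1 else 0)) = g a"
    if "a < m k" for a k and g :: "nat \<Rightarrow> real"
    using that by (simp_all add: if_distrib if_distribR cong: if_cong)
  \<comment> \<open>Since \<open>J J = m J\<close>, the product is
    \<open>I + J - (1 + m) J / (m + 1) = I\<close>.\<close>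
  have B_inverse: "(\<Sum>c<m k. ((if a = c then 1 else 0) + 1) *
      ((if c = b then 1 else 0) - 1 / (real (m k) + 1))) = (if a = b then 1 else 0)"
    if "a < m k" "b < m k" for a b k
    using that unfolding distrib_right sum.distrib delta(1)[OF that(1)]
    by (simp add: sum_subtractf) (simp add: field_simps)
  have DE: "(\<Sum>r\<in>{r\<in>V. \<kappa> r = \<kappa> v}. D u r * E r v) = (if u = v then 1 else 0)"
    if "u \<in> V" "v \<in> V" "\<kappa> u = \<kappa> v" for u v
    using vertex[OF that(1)] vertex[OF that(2)] that(3) B_inverse
    by (auto simp: block entries split: if_splits)
  \<comment> \<open>On the even part this is \<open>B 1 = (m + 1) 1\<close>; on the odd part
    \<open>B y = y\<close>, because \<open>J y = 0\<close>.\<close>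
  have Dw: "(\<Sum>r\<in>{r\<in>V. \<kappa> r = \<kappa> u}. D u r * w r) = z u" if "u \<in> V" for u
    using vertex[OF that]
    by (auto simp: block entries distrib_right sum.distrib delta y_sum)
  \<comment> \<open>On the even part the inverse of \<open>B\<close> fixes \<open>y\<close>; on the
    odd part it divides \<open>(m + 1) 1\<close> by \<open>m + 1\<close>.\<close>
  have zE: "(\<Sum>r\<in>{r\<in>V. \<kappa> r = \<kappa> v}. z r * E r v) = w v" if "v \<in> V" for v
    using vertex[OF that]
    by (auto simp: block entries right_diff_distrib sum_subtractf delta y_sum
        sum_divide_distrib[symmetric])
  have zw: "(\<Sum>r\<in>{r\<in>V. \<kappa> r = \<kappa> u}. z r * w r) = 0" if "u \<in> V" for u
    using vertex[OF that]
    by (auto simp: block entries sum_distrib_left[symmetric] y_sum)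
  have z_nz: "z u \<noteq> 0" if "u \<in> V" for u
    using that y_nz by (auto simp: z_def V add_eq_0_iff)
  show ?thesis
    unfolding ms_def[symmetric]
  proof (rule complete_multipartite_property_P_if_kernel[of ms
        "\<lambda>u v. if \<kappa> u = \<kappa> v then D u v else z u * z v"
        "\<lambda>u v. if \<kappa> u = \<kappa> v then E u v else - (w u * w v)"], unfold V_def[symmetric])
    fix u v assume uv: "u \<in> V" "v \<in> V"
    show "(if \<kappa> u = \<kappa> v then D u v else z u * z v) = (if \<kappa> v = \<kappa> u then D v u else z v * z u)"
      by (auto simp: D_def)
    show "(\<Sum>r\<in>V. (if \<kappa> u = \<kappa> r then D u r else z u * z r) *
        (if \<kappa> r = \<kappa> v then E r v else - (w r * w v))) = (if u = v then 1 else 0)"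
      by (rule block_rank_one_inverse[OF fin DE Dw zE zw uv])
    \<comment> \<open>Inside a block, entries between the two parts are 1 or 2; across blocks the
      parts always differ and \<open>z_nz\<close> gives a nonzero product.\<close>
    show "(if \<kappa> u = \<kappa> v then D u v else z u * z v) \<noteq> 0 \<longleftrightarrow> fst u \<noteq> fst v" if "u \<noteq> v"
      using z_nz uv by (auto simp: D_def \<kappa>_def)
    show "(if \<kappa> u = \<kappa> u then E u u else - (w u * w u)) = 0"
      by (simp add: E_def)
  qed
qed

end
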